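(* Let $X$ be a complex Banach space, let $m \geq 1$ be an integer, and let $\varphi : X \to X$ be a continuous linear map. Then the composition operator $C_\varphi : \mathcal{P}(^m X)_{\tau_0} \to \mathcal{P}(^m X)_{\tau_0}$, $C_\varphi(p) = p \circ \varphi$, is power bounded if and only if $\varphi$ has stable orbits.
   Context: An $m$-homogeneous polynomial $p : X \to \mathbb{C}$ is a mapping of the form $p(x) = L(x, \ldots, x)$ with $L : X \times \cdots \times X \to \mathbb{C}$ a continuous $m$-linear form; $\mathcal{P}(^m X)$ denotes the vector space of all of them, and $\mathcal{P}(^m X)_{\tau_0}$ is this space endowed with the compact-open topology $\tau_0$, i.e. the topology of uniform convergence on the compact subsets of $X$. A continuous linear operator $T$ on a locally convex Hausdorff space $E$ is power bounded if the sequence of iterates $(T^n)_{n \in \mathbb{N}}$ is equicontinuous. A continuous linear map $\varphi : X \to X$ has stable orbits if for every compact set $K \subseteq X$ there is a compact set $L \subseteq X$ such that $\varphi^n(K) \subseteq L$ for every $n \in \mathbb{N}$, where $\varphi^n$ is the $n$-fold composition of $\varphi$ with itself. *)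

theory Defs
  imports "HOL-Analysis.Analysis" "HOL-Library.Function_Algebras"
begin

class complex_vector = ab_group_add +
  fixes scaleC :: "complex \<Rightarrow> 'a \<Rightarrow> 'a"  (infixr "*\<^sub>C" 75)
  assumes scaleC_add_right: "c *\<^sub>C (x + y) = c *\<^sub>C x + c *\<^sub>C y"
    and scaleC_add_left: "(b + c) *\<^sub>C x = b *\<^sub>C x + c *\<^sub>C x"
    and scaleC_scaleC: "b *\<^sub>C (c *\<^sub>C x) = (b * c) *\<^sub>C x"
    and scaleC_one: "1 *\<^sub>C x = x"

class complex_banach = complex_vector + banach +
  assumes scaleR_scaleC: "r *\<^sub>R x = complex_of_real r *\<^sub>C x"
    and norm_scaleC: "norm (c *\<^sub>C x) = cmod c * norm x"

instantiation complex :: complex_vector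
begin
definition scaleC_complex_def: "c *\<^sub>C (z::complex) = c * z"
instance by standard (simp_all add: scaleC_complex_def algebra_simps)
end

instance complex :: complex_banach
  by standard (simp_all add: scaleC_complex_def scaleR_conv_of_real norm_mult)

instantiation "fun" :: (type, complex_vector) complex_vector
begin
definition scaleC_fun_def: "c *\<^sub>C f = (\<lambda>x. c *\<^sub>C f x)"
instance
  by standard
    (simp_all add: scaleC_fun_def fun_eq_iff scaleC_add_right scaleC_add_left scaleC_scaleC scaleC_one)
end

lemma vector_space_scaleC: "vector_space (scaleC :: complex \<Rightarrow> 'a \<Rightarrow> 'a::complex_vector)"
  by standard (simp_all add: scaleC_add_right scaleC_add_left scaleC_scaleC scaleC_one)

abbreviation clinear :: "('a::complex_vector \<Rightarrow> 'b::complex_vector) \<Rightarrow> bool"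
  where "clinear \<equiv> Vector_Spaces.linear scaleC scaleC"

text \<open>The \<open>m\<close>-fold product of the space is modelled by the extensional functions on \<open>{..<m}\<close>,
  which form the carrier of the product topology below.\<close>

definition continuous_multilinear_form ::
    "nat \<Rightarrow> ((nat \<Rightarrow> 'a::complex_banach) \<Rightarrow> complex) \<Rightarrow> bool"
  where "continuous_multilinear_form m L \<longleftrightarrow>
    (\<forall>x \<in> {..<m} \<rightarrow>\<^sub>E UNIV. \<forall>i<m. clinear (\<lambda>y. L (x(i := y)))) \<and>
    continuous_map (product_topology (\<lambda>_. euclidean) {..<m}) euclidean L"

definition homogeneous_polynomials :: "nat \<Rightarrow> ('a::complex_banach \<Rightarrow> complex) set"
  where "homogeneous_polynomials m =
    {p. \<exists>L. continuous_multilinear_form m L \<and> (\<forall>x. p x = L (\<lambda>i\<in>{..<m}. x))}"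

text \<open>Topology of uniform convergence on compact sets, on a space \<open>F\<close> of functions.\<close>

definition compact_open_topology ::
    "('a::topological_space \<Rightarrow> 'b::real_normed_vector) set \<Rightarrow> ('a \<Rightarrow> 'b) topology"
  where "compact_open_topology F = topology_generated_by
    {{g \<in> F. \<forall>x\<in>K. norm (g x - f x) < e} | f K e. f \<in> F \<and> compact K \<and> e > 0}"

lemma topspace_compact_open_topology [simp]: "topspace (compact_open_topology F) = F"
proof -
  have "\<exists>U\<in>{{g \<in> F. \<forall>x\<in>K. norm (g x - f x) < e} | f K e. f \<in> F \<and> compact K \<and> e > 0}. f \<in> U"
    if "f \<in> F" for f
    using that by (intro bexI[of _ F]) (auto intro!: exI[of _ f] exI[of _ "{}"] exI[of _ 1])
  then show ?thesis
    unfolding compact_open_topology_def topology_generated_by_topspace by fastforce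
qed

text \<open>In the next two definitions \<open>\<tau>\<close> is a vector space topology whose carrier \<open>topspace \<tau>\<close> is
  a linear subspace of the type \<open>'b\<close>; equicontinuity refers to the uniformity of \<open>\<tau>\<close>, given by
  the neighbourhoods of 0.\<close>

definition equicontinuous_family :: "'b::complex_vector topology \<Rightarrow> (nat \<Rightarrow> 'b \<Rightarrow> 'b) \<Rightarrow> bool"
  where "equicontinuous_family \<tau> S \<longleftrightarrow>
    (\<forall>f \<in> topspace \<tau>. \<forall>V. openin \<tau> V \<and> 0 \<in> V \<longrightarrow>
      (\<exists>U. openin \<tau> U \<and> f \<in> U \<and> (\<forall>n. \<forall>g\<in>U. S n g - S n f \<in> V)))"

definition power_bounded :: "'b::complex_vector topology \<Rightarrow> ('b \<Rightarrow> 'b) \<Rightarrow> bool"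
  where "power_bounded \<tau> T \<longleftrightarrow>
    continuous_map \<tau> \<tau> T \<and>
    (\<forall>f \<in> topspace \<tau>. \<forall>g \<in> topspace \<tau>. T (f + g) = T f + T g) \<and>
    (\<forall>c. \<forall>f \<in> topspace \<tau>. T (c *\<^sub>C f) = c *\<^sub>C T f) \<and>
    equicontinuous_family \<tau> (\<lambda>n. T ^^ n)"

definition stable_orbits :: "('a::topological_space \<Rightarrow> 'a) \<Rightarrow> bool"
  where "stable_orbits \<phi> \<longleftrightarrow>
    (\<forall>K. compact K \<longrightarrow> (\<exists>L. compact L \<and> (\<forall>n. (\<phi> ^^ n) ` K \<subseteq> L)))"

definition composition_operator :: "('a \<Rightarrow> 'a) \<Rightarrow> ('a \<Rightarrow> 'b) \<Rightarrow> 'a \<Rightarrow> 'b"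
  where "composition_operator \<phi> p = p \<circ> \<phi>"

end

theory Submission imports Defs begin

text \<open>
  Suppose first that \<open>\<phi>\<close> has stable orbits. The \<open>n\<close>-th iterate of the composition operator is
  composition with \<open>\<phi> ^^ n\<close>, so on a compact \<open>K\<close> the functions \<open>g \<circ> \<phi> ^^ n\<close> and \<open>f \<circ> \<phi> ^^ n\<close>
  differ by no more than \<open>g\<close> and \<open>f\<close> do on a compact set that contains all the \<open>(\<phi> ^^ n) ` K\<close>.
  That is equicontinuity.

  Conversely, let \<open>K\<close> be compact. Equicontinuity at \<open>0\<close> yields a compact \<open>L\<close> and \<open>e > 0\<close> such that
  every polynomial \<open>p\<close> with \<open>\<bar>p\<bar> < e\<close> on \<open>L\<close> satisfies \<open>\<bar>p\<bar> < 1\<close> on all the \<open>(\<phi> ^^ n) ` K\<close>. The only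
  polynomials needed are the powers \<open>F ^ m\<close> of continuous linear forms: if \<open>\<bar>F\<bar> \<le> 1\<close> on
  \<open>R \<cdot> L\<close> for a suitable large \<open>R\<close>, then \<open>\<bar>F ^ m\<bar> < e\<close> on \<open>L\<close>, and hence \<open>\<bar>F\<bar> < 1\<close> on all
  the \<open>(\<phi> ^^ n) ` K\<close>. By the bipolar theorem these sets lie in the closed absolutely convex hull
  of \<open>R \<cdot> L\<close>, which is compact by Mazur's theorem.

  The two ingredients are thus Mazur's theorem (\<open>compact_closure_convex_hull\<close>) and the separation
  of a point from a closed absolutely convex set (\<open>absolutely_convex_separation\<close>). The latter
  rests on the Hahn--Banach theorem, obtained here from the fact that a minimal sublinear
  functional is linear.
\<close>

section \<open>The Hahn--Banach theorem via minimal sublinear functionals\<close>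

text \<open>Positive homogeneity is required with \<open>\<le>\<close> only: applying the inequality to \<open>1 / t\<close> as well
  makes it an equality, and the one-sided form is easier to establish for infima.\<close>

definition sublinear :: "('a::real_vector \<Rightarrow> real) \<Rightarrow> bool"
  where "sublinear p \<longleftrightarrow> (\<forall>x y. p (x + y) \<le> p x + p y) \<and> (\<forall>t x. t \<ge> 0 \<longrightarrow> p (t *\<^sub>R x) \<le> t * p x)"

lemma sublinearI:
  assumes "\<And>x y. p (x + y) \<le> p x + p y" "\<And>t x. t \<ge> 0 \<Longrightarrow> p (t *\<^sub>R x) \<le> t * p x"
  shows "sublinear p"
  using assms by (simp add: sublinear_def)

lemma sublinear_add: "sublinear p \<Longrightarrow> p (x + y) \<le> p x + p y"
  by (simp add: sublinear_def)

lemma sublinear_scaleR_le: "sublinear p \<Longrightarrow> t \<ge> 0 \<Longrightarrow> p (t *\<^sub>R x) \<le> t * p x"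
  by (simp add: sublinear_def)

lemma sublinear_zero:
  assumes "sublinear p"
  shows "p 0 = 0"
  using sublinear_add[OF assms, of 0 0] sublinear_scaleR_le[OF assms, of 0 0] by simp

lemma sublinear_minus_le: "sublinear p \<Longrightarrow> - p (- x) \<le> p x"
  using sublinear_add[of p x "- x"] sublinear_zero[of p] by simp

lemma sublinear_scaleR:
  assumes p: "sublinear p" and t: "t \<ge> 0"
  shows "p (t *\<^sub>R x) = t * p x"
proof (cases "t = 0")
  case True
  then show ?thesis by (simp add: sublinear_zero[OF p])
next
  case False
  then have "p x \<le> (1 / t) * p (t *\<^sub>R x)"
    using sublinear_scaleR_le[OF p, of "1 / t" "t *\<^sub>R x"] t by simp
  then have "t * p x \<le> p (t *\<^sub>R x)"
    using False t by (simp add: field_simps)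
  then show ?thesis
    using sublinear_scaleR_le[OF p t, of x] by simp
qed

text \<open>The functional \<open>x \<mapsto> inf {p (x + t y) - t p(y) | t \<ge> 0}\<close> has the required properties: the
  parameter \<open>t = 0\<close> shows that it lies below \<open>p\<close>, and \<open>t = 1\<close> bounds its value at \<open>- y\<close>. It is used
  twice: a minimal sublinear functional cannot be lowered, hence is odd; and lowering a given
  functional at \<open>- y\<close> forces every linear minorant to be maximal at \<open>y\<close>.\<close>

lemma sublinear_lower:
  fixes p :: "'a::real_vector \<Rightarrow> real"
  assumes p: "sublinear p"
  obtains p' where "sublinear p'" "p' \<le> p" "p' (- y) \<le> - p y"
proof
  define p' where "p' = (\<lambda>x. INF t\<in>{0..}. p (x + t *\<^sub>R y) - t * p y)"
  have lower: "- p (- x) \<le> p (x + t *\<^sub>R y) - t * p y" if "t \<ge> 0" for x t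
    using sublinear_add[OF p, of "x + t *\<^sub>R y" "- x"] sublinear_scaleR[OF p that, of y] by simp
  then have bdd: "bdd_below ((\<lambda>t. p (x + t *\<^sub>R y) - t * p y) ` {0..})" for x
    by (intro bdd_belowI[of _ "- p (- x)"]) auto
  have le: "p' x \<le> p (x + t *\<^sub>R y) - t * p y" if "t \<ge> 0" for x t
    unfolding p'_def using that by (intro cINF_lower[OF bdd]) auto
  have ge: "c \<le> p' x" if "\<And>t. t \<ge> 0 \<Longrightarrow> c \<le> p (x + t *\<^sub>R y) - t * p y" for c x
    unfolding p'_def using that by (intro cINF_greatest) auto
  show "sublinear p'"
  proof (rule sublinearI)
    fix u v
    have "p' (u + v) - (p (v + t *\<^sub>R y) - t * p y) \<le> p (u + s *\<^sub>R y) - s * p y"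
      if "s \<ge> 0" "t \<ge> 0" for s t
      using le[of "s + t" "u + v"] sublinear_add[OF p, of "u + s *\<^sub>R y" "v + t *\<^sub>R y"] that
      by (simp add: algebra_simps)
    then have "p' (u + v) - (p (v + t *\<^sub>R y) - t * p y) \<le> p' u" if "t \<ge> 0" for t
      using that by (intro ge) auto
    then have "p' (u + v) - p' u \<le> p (v + t *\<^sub>R y) - t * p y" if "t \<ge> 0" for t
      using that by (simp add: algebra_simps)
    then have "p' (u + v) - p' u \<le> p' v"
      by (rule ge)
    then show "p' (u + v) \<le> p' u + p' v" by simp
  next
    fix s :: real and x
    assume s: "s \<ge> 0"
    have *: "p' (s *\<^sub>R x) \<le> s * (p (x + t *\<^sub>R y) - t * p y)" if "t \<ge> 0" for t
      using le[of "s * t" "s *\<^sub>R x"] sublinear_scaleR_le[OF p s, of "x + t *\<^sub>R y"] s that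
      by (simp add: algebra_simps)
    show "p' (s *\<^sub>R x) \<le> s * p' x"
    proof (cases "s = 0")
      case True
      then show ?thesis using *[of 0] by simp
    next
      case False
      then have "p' (s *\<^sub>R x) / s \<le> p' x"
        using * s by (intro ge) (simp add: field_simps)
      then show ?thesis using False s by (simp add: field_simps)
    qed
  qed
  show "p' \<le> p"
    using le[of 0] by (auto simp: le_fun_def)
  show "p' (- y) \<le> - p y"
    using le[of 1 "- y"] sublinear_zero[OF p] by simp
qed

lemma minimal_sublinear_imp_linear:
  fixes p :: "'a::real_vector \<Rightarrow> real"
  assumes p: "sublinear p" and minimal: "\<And>p'. sublinear p' \<Longrightarrow> p' \<le> p \<Longrightarrow> p' = p"
  shows "linear p"
proof -
  have odd: "p (- y) = - p y" for y
  proof -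
    obtain p' where "sublinear p'" "p' \<le> p" "p' (- y) \<le> - p y"
      using sublinear_lower[OF p] .
    then show ?thesis
      using minimal sublinear_minus_le[OF p, of "- y"] by fastforce
  qed
  show ?thesis
  proof (rule linearI)
    fix x y
    show "p (x + y) = p x + p y"
      using sublinear_add[OF p, of x y] sublinear_add[OF p, of "x + y" "- y"] odd[of y] by simp
  next
    fix t x
    show "p (t *\<^sub>R x) = t *\<^sub>R p x"
    proof (cases "t \<ge> 0")
      case True
      then show ?thesis by (simp add: sublinear_scaleR[OF p])
    next
      case False
      then show ?thesis
        using sublinear_scaleR[OF p, of "- t" x] odd[of "t *\<^sub>R x"] by simp
    qed
  qed
qed

text \<open>The pointwise infimum works because, of two members of the chain, the smaller one may be
  used at both arguments.\<close>

lemma sublinear_chain_lower_bound: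
  fixes q :: "'a::real_vector \<Rightarrow> real"
  assumes ne: "C \<noteq> {}" and sub: "\<And>p. p \<in> C \<Longrightarrow> sublinear p" and q: "\<And>p. p \<in> C \<Longrightarrow> p \<le> q"
    and chain: "\<And>p p'. p \<in> C \<Longrightarrow> p' \<in> C \<Longrightarrow> p \<le> p' \<or> p' \<le> p"
  obtains u where "sublinear u" "\<And>p. p \<in> C \<Longrightarrow> u \<le> p"
proof
  define u where "u = (\<lambda>x. INF p\<in>C. p x)"
  have "- q (- x) \<le> p x" if "p \<in> C" for p x
    using sublinear_minus_le[OF sub[OF that], of x] le_funD[OF q[OF that], of "- x"] by simp
  then have bdd: "bdd_below ((\<lambda>p. p x) ` C)" for x
    by (intro bdd_belowI[of _ "- q (- x)"]) auto
  have le: "u x \<le> p x" if "p \<in> C" for p x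
    unfolding u_def using that by (intro cINF_lower[OF bdd])
  have ge: "c \<le> u x" if "\<And>p. p \<in> C \<Longrightarrow> c \<le> p x" for c x
    unfolding u_def using that ne by (intro cINF_greatest) auto
  show "sublinear u"
  proof (rule sublinearI)
    fix x y
    have "u (x + y) \<le> p x + p' y" if C: "p \<in> C" "p' \<in> C" for p p'
      using chain[OF C]
    proof
      assume "p \<le> p'"
      then show ?thesis
        using le[OF C(1), of "x + y"] sublinear_add[OF sub[OF C(1)], of x y] le_funD[of p p' y]
        by simp
    next
      assume "p' \<le> p"
      then show ?thesis
        using le[OF C(2), of "x + y"] sublinear_add[OF sub[OF C(2)], of x y] le_funD[of p' p x]
        by simp
    qed
    then have "u (x + y) - p' y \<le> u x" if "p' \<in> C" for p'
      using that by (intro ge) (simp add: algebra_simps)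
    then have "u (x + y) - u x \<le> u y"
      by (intro ge) (simp add: algebra_simps)
    then show "u (x + y) \<le> u x + u y" by simp
  next
    fix t :: real and x
    assume t: "t \<ge> 0"
    have *: "u (t *\<^sub>R x) \<le> t * p x" if "p \<in> C" for p
      using le[OF that, of "t *\<^sub>R x"] sublinear_scaleR_le[OF sub[OF that] t, of x] by simp
    show "u (t *\<^sub>R x) \<le> t * u x"
    proof (cases "t = 0")
      case True
      then show ?thesis using * ne by auto
    next
      case False
      then have "u (t *\<^sub>R x) / t \<le> u x"
        using * t by (intro ge) (simp add: field_simps)
      then show ?thesis using False t by (simp add: field_simps)
    qed
  qed
  show "u \<le> p" if "p \<in> C" for p
    using le[OF that] by (simp add: le_fun_def)
qed

lemma ex_linear_le_sublinear:
  fixes q :: "'a::real_vector \<Rightarrow> real"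
  assumes q: "sublinear q"
  obtains f where "linear f" "f \<le> q"
proof -
  let ?A = "{p. sublinear p \<and> p \<le> q}"
  have "\<exists>m\<in>?A. \<forall>p\<in>?A. m \<ge> p \<longrightarrow> p = m"
  proof (rule predicate_Zorn)
    show "partial_order_on ?A (relation_of (\<ge>) ?A)"
      by (rule partial_order_on_relation_ofI) auto
  next
    fix C
    assume C: "C \<in> Chains (relation_of (\<ge>) ?A)"
    show "\<exists>u\<in>?A. \<forall>p\<in>C. p \<ge> u"
    proof (cases "C = {}")
      case True
      then show ?thesis using q by auto
    next
      case False
      have CA: "p \<in> ?A" if "p \<in> C" for p
        using C that by (auto simp: Chains_def relation_of_def)
      have "p \<le> p' \<or> p' \<le> p" if "p \<in> C" "p' \<in> C" for p p'
        using C that by (auto simp: Chains_def relation_of_def)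
      then obtain u where u: "sublinear u" "\<And>p. p \<in> C \<Longrightarrow> u \<le> p"
        using sublinear_chain_lower_bound[OF False] CA by (metis (no_types, lifting) mem_Collect_eq)
      moreover have "u \<le> q"
        using False u(2) CA by (force intro: order_trans)
      ultimately show ?thesis by auto
    qed
  qed
  then obtain m where "sublinear m" "m \<le> q"
    and "\<And>p. sublinear p \<Longrightarrow> p \<le> q \<Longrightarrow> p \<le> m \<Longrightarrow> p = m" by auto
  then have "linear m"
    by (intro minimal_sublinear_imp_linear) (auto intro: order_trans)
  then show thesis using \<open>m \<le> q\<close> that by blast
qed

lemma Hahn_Banach_real:
  fixes q :: "'a::real_vector \<Rightarrow> real"
  assumes q: "sublinear q"
  obtains f where "linear f" "f \<le> q" "f y = q y"
proof -
  obtain p where p: "sublinear p" "p \<le> q" "p (- y) \<le> - q y"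
    using sublinear_lower[OF q] .
  obtain f where f: "linear f" "f \<le> p"
    using ex_linear_le_sublinear[OF p(1)] .
  have "f (- y) \<le> - q y"
    using le_funD[OF f(2), of "- y"] p(3) by simp
  then have "q y \<le> f y"
    by (simp add: linear_neg[OF f(1)])
  moreover have "f \<le> q" using f(2) p(2) by simp
  ultimately show thesis
    using that[OF f(1)] by (metis le_funD order_antisym)
qed

section \<open>Separation in complex Banach spaces\<close>

lemma clinear_iff:
  "clinear f \<longleftrightarrow> (\<forall>x y. f (x + y) = f x + f y) \<and> (\<forall>c x. f (c *\<^sub>C x) = c *\<^sub>C f x)"
  by (simp add: Vector_Spaces.linear_iff vector_space_scaleC)

lemma clinear_imp_linear:
  fixes f :: "'a::complex_banach \<Rightarrow> 'b::complex_banach"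
  shows "clinear f \<Longrightarrow> linear f"
  by (intro linearI) (simp_all add: clinear_iff scaleR_scaleC)

lemma scaleC_scaleR_commute:
  fixes x :: "'a::complex_banach"
  shows "c *\<^sub>C (r *\<^sub>R x) = r *\<^sub>R (c *\<^sub>C x)"
  by (simp add: scaleR_scaleC scaleC_scaleC mult.commute)

lemma scaleC_diff_right:
  fixes x y :: "'a::complex_banach"
  shows "c *\<^sub>C (x - y) = c *\<^sub>C x - c *\<^sub>C y"
  by (metis add_diff_cancel diff_add_cancel scaleC_add_right)

lemma scaleC_eq_Re_Im:
  fixes x :: "'a::complex_banach"
  shows "c *\<^sub>C x = Re c *\<^sub>R x + Im c *\<^sub>R (\<i> *\<^sub>C x)"
proof -
  have "c = complex_of_real (Re c) + complex_of_real (Im c) * \<i>"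
    by (simp add: complex_eq_iff)
  then show ?thesis
    by (metis scaleC_add_left scaleC_scaleC scaleR_scaleC)
qed

text \<open>A real linear \<open>f \<le> q\<close> is the real part of the complex linear form \<open>f(x) - i f(i x)\<close>; rotating
  \<open>x\<close> so that the value of the form becomes real and nonnegative shows that its modulus is
  dominated by \<open>q\<close> as well.\<close>

lemma Hahn_Banach_complex:
  fixes q :: "'a::complex_banach \<Rightarrow> real"
  assumes q: "sublinear q" and rot: "\<And>c x. cmod c = 1 \<Longrightarrow> q (c *\<^sub>C x) \<le> q x"
  obtains F where "clinear F" "\<And>x. cmod (F x) \<le> q x" "q y \<le> cmod (F y)"
proof -
  obtain f where f: "linear f" "f \<le> q" "f y = q y"
    using Hahn_Banach_real[OF q] .
  define F where "F = (\<lambda>x. Complex (f x) (- f (\<i> *\<^sub>C x)))"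
  have Re_F: "Re (F x) = f x" for x
    by (simp add: F_def)
  have "F (c *\<^sub>C x) = c * F x" for c x
  proof -
    have ii: "\<i> *\<^sub>C (\<i> *\<^sub>C x) = - x"
      using scaleR_scaleC[of "-1" x] by (simp add: scaleC_scaleC)
    have "\<i> *\<^sub>C (c *\<^sub>C x) = Re c *\<^sub>R (\<i> *\<^sub>C x) - Im c *\<^sub>R x"
      by (subst scaleC_eq_Re_Im[of c]) (simp add: scaleC_add_right scaleC_scaleR_commute ii)
    then have "f (\<i> *\<^sub>C (c *\<^sub>C x)) = Re c * f (\<i> *\<^sub>C x) - Im c * f x"
      by (simp add: linear_diff[OF f(1)] linear_scale[OF f(1)])
    moreover have "f (c *\<^sub>C x) = Re c * f x + Im c * f (\<i> *\<^sub>C x)"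
      by (subst scaleC_eq_Re_Im) (simp add: linear_add[OF f(1)] linear_scale[OF f(1)])
    ultimately show ?thesis
      by (simp add: F_def complex_eq_iff)
  qed
  moreover have "F (x + y) = F x + F y" for x y
    by (simp add: F_def scaleC_add_right linear_add[OF f(1)] complex_eq_iff)
  ultimately have F: "clinear F"
    by (simp add: clinear_iff scaleC_complex_def)
  have "cmod (F x) \<le> q x" for x
  proof -
    obtain c where c: "cmod c = 1" "c * F x = complex_of_real (cmod (F x))"
    proof (cases "F x = 0")
      case True
      then show thesis using that[of 1] by simp
    next
      case False
      have "cnj (F x) * F x = complex_of_real (cmod (F x) * cmod (F x))"
        by (metis complex_norm_square mult.commute power2_eq_square)
      then show thesis
        using False by (intro that[of "cnj (F x) / cmod (F x)"]) (simp_all add: norm_divide)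
    qed
    have "cmod (F x) = f (c *\<^sub>C x)"
      using F c(2) by (simp add: clinear_iff scaleC_complex_def flip: Re_F)
    also have "\<dots> \<le> q x"
      using le_funD[OF f(2)] rot[OF c(1)] by (rule order_trans)
    finally show ?thesis .
  qed
  moreover have "q y \<le> cmod (F y)"
    using complex_Re_le_cmod[of "F y"] by (simp add: Re_F f(3))
  ultimately show thesis using F that by blast
qed

text \<open>Choose \<open>e > 0\<close> not exceeding the distance from \<open>z\<close> to \<open>B\<close>, and let
  \<open>q(x) = inf {s + \<parallel>x - s b\<parallel> / e | s \<ge> 0, b \<in> B}\<close>.
  This is the largest seminorm that is at most \<open>1\<close> on \<open>B\<close> and at most \<open>\<parallel>x\<parallel> / e\<close> everywhere, and
  \<open>q(z) \<ge> 1\<close>: if \<open>s \<le> 1\<close>, then \<open>s b \<in> B\<close> and the second summand is already at least \<open>1\<close>. The linear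
  form supplied by the Hahn--Banach theorem is bounded because \<open>q\<close> is.\<close>

lemma absolutely_convex_separation:
  fixes B :: "'a::complex_banach set"
  assumes "closed B" "convex B" "B \<noteq> {}"
    and balanced: "\<And>c x. cmod c \<le> 1 \<Longrightarrow> x \<in> B \<Longrightarrow> c *\<^sub>C x \<in> B"
    and "z \<notin> B"
  obtains F where "clinear F" "continuous_on UNIV F" "\<And>x. x \<in> B \<Longrightarrow> cmod (F x) \<le> 1" "1 \<le> cmod (F z)"
proof -
  obtain e where "e > 0" "ball z e \<subseteq> - B"
    using \<open>closed B\<close> \<open>z \<notin> B\<close> by (metis ComplI open_Compl openE)
  then have e: "e > 0" "\<And>b. b \<in> B \<Longrightarrow> e \<le> dist z b"
    by (auto simp: subset_iff not_less[symmetric])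
  define v where "v = (\<lambda>(x::'a) (s, b). s + norm (x - s *\<^sub>R b) / e)"
  define q where "q = (\<lambda>x. INF sb\<in>{0..} \<times> B. v x sb)"
  have v_nonneg: "0 \<le> v x (s, b)" if "s \<ge> 0" for x s b
    using that e(1) by (simp add: v_def)
  then have bdd: "bdd_below (v x ` ({0..} \<times> B))" for x
    by (intro bdd_belowI[of _ 0]) auto
  have le: "q x \<le> v x (s, b)" if "s \<ge> 0" "b \<in> B" for x s b
    unfolding q_def using that by (intro cINF_lower[OF bdd]) auto
  have ge: "r \<le> q x" if "\<And>s b. s \<ge> 0 \<Longrightarrow> b \<in> B \<Longrightarrow> r \<le> v x (s, b)" for r x
    unfolding q_def using that \<open>B \<noteq> {}\<close> by (intro cINF_greatest) auto
  have sub: "sublinear q"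
  proof (rule sublinearI)
    fix x y
    have *: "q (x + y) \<le> v x (s, b) + v y (t, b')"
      if st: "s \<ge> 0" "t \<ge> 0" and b: "b \<in> B" "b' \<in> B" for s t b b'
    proof -
      obtain b'' where b'': "b'' \<in> B" "(s + t) *\<^sub>R b'' = s *\<^sub>R b + t *\<^sub>R b'"
      proof (cases "s + t = 0")
        case True
        then show thesis using st b that[of b] by (simp add: add_nonneg_eq_0_iff)
      next
        case False
        then have "(s / (s + t)) *\<^sub>R b + (t / (s + t)) *\<^sub>R b' \<in> B"
          using st b by (intro convexD[OF \<open>convex B\<close>]) (auto simp: add_divide_distrib[symmetric])
        then show thesis
          by (rule that) (use False in \<open>simp add: scaleR_add_right\<close>)
      qed
      have "norm (x + y - (s + t) *\<^sub>R b'') \<le> norm (x - s *\<^sub>R b) + norm (y - t *\<^sub>R b')"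
        unfolding b''(2) using norm_triangle_ineq[of "x - s *\<^sub>R b" "y - t *\<^sub>R b'"]
        by (simp add: algebra_simps)
      then have "v (x + y) (s + t, b'') \<le> v x (s, b) + v y (t, b')"
        using e(1) by (simp add: v_def divide_right_mono flip: add_divide_distrib)
      then show ?thesis
        using le[of "s + t" b'' "x + y"] st b''(1) by simp
    qed
    have "q (x + y) - v y (t, b') \<le> q x" if "t \<ge> 0" "b' \<in> B" for t b'
    proof (rule ge)
      fix s b assume "s \<ge> (0::real)" "b \<in> B"
      then show "q (x + y) - v y (t, b') \<le> v x (s, b)"
        using *[of s t b b'] that by simp
    qed
    then have "q (x + y) - q x \<le> q y"
      by (intro ge) (simp add: algebra_simps)
    then show "q (x + y) \<le> q x + q y" by simp
  next
    fix t :: real and x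
    assume t: "t \<ge> 0"
    have *: "q (t *\<^sub>R x) \<le> t * v x (s, b)" if "s \<ge> 0" "b \<in> B" for s b
    proof -
      have "norm (t *\<^sub>R x - (t * s) *\<^sub>R b) = t * norm (x - s *\<^sub>R b)"
        using t by (metis abs_of_nonneg norm_scaleR scaleR_diff_right scaleR_scaleR)
      then have "v (t *\<^sub>R x) (t * s, b) = t * v x (s, b)"
        by (simp add: v_def algebra_simps)
      then show ?thesis
        using le[of "t * s" b "t *\<^sub>R x"] t that by simp
    qed
    show "q (t *\<^sub>R x) \<le> t * q x"
    proof (cases "t = 0")
      case True
      then show ?thesis using *[of 0] \<open>B \<noteq> {}\<close> by auto
    next
      case False
      then have "q (t *\<^sub>R x) / t \<le> q x"
        using * t by (intro ge) (simp add: field_simps)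
      then show ?thesis using False t by (simp add: field_simps)
    qed
  qed
  have rot: "q (c *\<^sub>C x) \<le> q x" if c: "cmod c = 1" for c x
  proof (rule ge)
    fix s b assume s: "s \<ge> (0::real)" and b: "b \<in> B"
    have "norm (c *\<^sub>C x - s *\<^sub>R (c *\<^sub>C b)) = norm (x - s *\<^sub>R b)"
      using c by (simp add: norm_scaleC flip: scaleC_scaleR_commute scaleC_diff_right)
    then have "v (c *\<^sub>C x) (s, c *\<^sub>C b) = v x (s, b)"
      by (simp add: v_def)
    then show "q (c *\<^sub>C x) \<le> v x (s, b)"
      using le[OF s balanced[of c b], of "c *\<^sub>C x"] b c by simp
  qed
  obtain F where F: "clinear F" "\<And>x. cmod (F x) \<le> q x" "q z \<le> cmod (F z)"
    using Hahn_Banach_complex[OF sub rot, of z] by blast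
  have q_norm: "q x \<le> norm x * (1 / e)" for x
    using le[of 0 _ x] \<open>B \<noteq> {}\<close> by (auto simp: v_def)
  have "bounded_linear F"
    using clinear_imp_linear[OF F(1)] order_trans[OF F(2) q_norm]
    by (intro bounded_linear.intro bounded_linear_axioms.intro) blast+
  then have "continuous_on UNIV F"
    by (rule linear_continuous_on)
  moreover have "cmod (F x) \<le> 1" if "x \<in> B" for x
    using F(2)[of x] le[of 1 x x] that by (simp add: v_def)
  moreover have "1 \<le> q z"
  proof (rule ge)
    fix s b assume s: "s \<ge> (0::real)" and b: "b \<in> B"
    show "1 \<le> v z (s, b)"
    proof (cases "s \<le> 1")
      case True
      have "s *\<^sub>R b \<in> B"
        using balanced[of "complex_of_real s" b] b s True by (simp add: scaleR_scaleC)
      then have "1 \<le> norm (z - s *\<^sub>R b) / e"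
        using e by (simp add: dist_norm)
      then show ?thesis using s by (simp add: v_def)
    next
      case False
      have "0 \<le> norm (z - s *\<^sub>R b) / e"
        using e(1) by simp
      then show ?thesis using False by (simp add: v_def)
    qed
  qed
  ultimately show thesis using F that by fastforce
qed

section \<open>Compactness of closed absolutely convex hulls\<close>

text \<open>Mazur's theorem. Up to a small ball, a compact set is contained in a finite set, so its convex
  hull is contained in the convex hull of a finite set, which is compact; completeness of the
  space does the rest.\<close>

lemma compact_closure_convex_hull:
  fixes S :: "'a::banach set"
  assumes "compact S"
  shows "compact (closure (convex hull S))"
  unfolding compact_eq_totally_bounded
proof (intro conjI allI impI)
  show "complete (closure (convex hull S))"
    by (simp add: complete_eq_closed)
next
  fix e :: real
  assume "e > 0"
  define d where "d = e / 3"
  have d: "d > 0" using \<open>e > 0\<close> by (simp add: d_def)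
  obtain k where k: "finite k" "S \<subseteq> (\<Union>x\<in>k. ball x d)"
    using assms d unfolding compact_eq_totally_bounded by blast
  have "S \<subseteq> convex hull k + ball 0 d"
  proof
    fix y assume "y \<in> S"
    then obtain x where x: "x \<in> k" "dist x y < d" using k(2) by auto
    then have "x + (y - x) \<in> convex hull k + ball 0 d"
      by (intro set_plus_intro) (auto simp: hull_inc dist_norm norm_minus_commute)
    then show "y \<in> convex hull k + ball 0 d" by simp
  qed
  then have conv: "convex hull S \<subseteq> convex hull k + ball 0 d"
    by (intro hull_minimal convex_set_plus) auto
  obtain k' where k': "finite k'" "convex hull k \<subseteq> (\<Union>x\<in>k'. ball x d)"
    using finite_imp_compact_convex_hull[OF k(1)] d unfolding compact_eq_totally_bounded by blast
  have "closure (convex hull S) \<subseteq> (\<Union>x\<in>k'. ball x e)"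
  proof
    fix y assume "y \<in> closure (convex hull S)"
    then obtain w where w: "w \<in> convex hull S" "dist w y < d"
      using d closure_approachable by blast
    then obtain a b where ab: "w = a + b" "a \<in> convex hull k" "norm b < d"
      using conv by (auto elim!: set_plus_elim dest!: subsetD)
    obtain x where x: "x \<in> k'" "dist x a < d" using k'(2) ab(2) by auto
    have "dist a w < d" using ab by (simp add: dist_norm)
    then have "dist x y < e"
      using x(2) w(2) dist_triangle[of x y a] dist_triangle[of a y w] by (simp add: d_def)
    then show "y \<in> (\<Union>x\<in>k'. ball x e)" using x(1) by auto
  qed
  then show "\<exists>k. finite k \<and> closure (convex hull S) \<subseteq> (\<Union>x\<in>k. ball x e)"
    using k'(1) by blast
qed

lemma bounded_linear_scaleC: "bounded_linear (\<lambda>x::'a::complex_banach. c *\<^sub>C x)"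
proof (rule bounded_linear_intro)
  show "norm (c *\<^sub>C x) \<le> norm x * cmod c" for x :: 'a
    by (simp add: norm_scaleC)
qed (simp_all add: scaleC_add_right scaleC_scaleR_commute)

lemma continuous_on_scaleC:
  "continuous_on UNIV (\<lambda>(c, x::'a::complex_banach). c *\<^sub>C x)"
proof -
  have "continuous_on UNIV (\<lambda>y::complex \<times> 'a. Re (fst y) *\<^sub>R snd y + Im (fst y) *\<^sub>R (\<i> *\<^sub>C snd y))"
    by (intro continuous_intros bounded_linear.continuous_on[OF bounded_linear_scaleC])
  then show ?thesis
    by (simp add: case_prod_beta flip: scaleC_eq_Re_Im)
qed

text \<open>The hull is taken of the union of the multiples \<open>c L\<close> with \<open>\<bar>c\<bar> \<le> R\<close>. This set is balanced, and
  convex hulls and closures inherit that; it is compact, so that Mazur's theorem applies.\<close>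

lemma compact_absolutely_convex_superset:
  fixes L :: "'a::complex_banach set"
  assumes "compact L" "L \<noteq> {}" "R \<ge> 0"
  obtains B where "compact B" "convex B" "B \<noteq> {}"
    "\<And>c x. cmod c \<le> 1 \<Longrightarrow> x \<in> B \<Longrightarrow> c *\<^sub>C x \<in> B" "\<And>x. x \<in> L \<Longrightarrow> R *\<^sub>R x \<in> B"
proof
  define S where "S = (\<lambda>(c, x). c *\<^sub>C x) ` (cball (0::complex) R \<times> L)"
  define B where "B = closure (convex hull S)"
  have "compact S"
    unfolding S_def using assms
    by (intro compact_continuous_image compact_Times continuous_on_subset[OF continuous_on_scaleC]) auto
  then show "compact B"
    unfolding B_def by (rule compact_closure_convex_hull)
  show "convex B"
    by (simp add: B_def convex_closure)
  have "S \<subseteq> B"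
    unfolding B_def using hull_subset closure_subset by (rule order_trans)
  then show RL: "R *\<^sub>R x \<in> B" if "x \<in> L" for x
    using that \<open>R \<ge> 0\<close> by (force simp: S_def scaleR_scaleC image_iff)
  then show "B \<noteq> {}"
    using \<open>L \<noteq> {}\<close> by blast
  fix c x
  assume c: "cmod c \<le> 1" and x: "x \<in> B"
  have bl: "bounded_linear (\<lambda>x::'a. c *\<^sub>C x)"
    by (rule bounded_linear_scaleC)
  have "(\<lambda>x. c *\<^sub>C x) ` S \<subseteq> S"
  proof clarify
    fix x assume "x \<in> S"
    then obtain a y where "x = a *\<^sub>C y" "cmod a \<le> R" "y \<in> L"
      by (auto simp: S_def)
    moreover have "cmod (c * a) \<le> R"
      using mult_mono[OF c \<open>cmod a \<le> R\<close>] by (simp add: norm_mult)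
    ultimately show "c *\<^sub>C x \<in> S"
      by (force simp: S_def scaleC_scaleC)
  qed
  then have "(\<lambda>x. c *\<^sub>C x) ` (convex hull S) \<subseteq> convex hull S"
    by (simp add: convex_hull_linear_image[OF bounded_linear.linear[OF bl]] hull_mono)
  moreover have "(\<lambda>x. c *\<^sub>C x) ` closure (convex hull S) \<subseteq> closure ((\<lambda>x. c *\<^sub>C x) ` (convex hull S))"
    by (intro image_closure_subset linear_continuous_on[OF bl] closed_closure closure_subset)
  ultimately have "(\<lambda>x. c *\<^sub>C x) ` B \<subseteq> B"
    unfolding B_def using closure_mono by blast
  then show "c *\<^sub>C x \<in> B" using x by blast
qed

section \<open>Homogeneous polynomials\<close>

lemma continuous_multilinear_form_clinear:
  "continuous_multilinear_form m L \<Longrightarrow> x \<in> {..<m} \<rightarrow>\<^sub>E UNIV \<Longrightarrow> i < m \<Longrightarrow> clinear (\<lambda>y. L (x(i := y)))"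
  by (simp add: continuous_multilinear_form_def)

lemma continuous_multilinear_form_continuous:
  "continuous_multilinear_form m L \<Longrightarrow>
    continuous_map (product_topology (\<lambda>_. euclidean) {..<m}) euclidean L"
  by (simp add: continuous_multilinear_form_def)

lemma homogeneous_polynomialsI:
  assumes "continuous_multilinear_form m L" "\<And>x. p x = L (\<lambda>i\<in>{..<m}. x)"
  shows "p \<in> homogeneous_polynomials m"
  using assms unfolding homogeneous_polynomials_def by blast

lemma homogeneous_polynomialsE:
  assumes "p \<in> homogeneous_polynomials m"
  obtains L where "continuous_multilinear_form m L" "\<And>x. p x = L (\<lambda>i\<in>{..<m}. x)"
  using assms unfolding homogeneous_polynomials_def by blast

lemma zero_mem_homogeneous_polynomials: "0 \<in> homogeneous_polynomials m"
proof -
  have "continuous_multilinear_form m (\<lambda>_. 0)"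
    by (simp add: continuous_multilinear_form_def clinear_iff scaleC_complex_def)
  then show ?thesis
    by (rule homogeneous_polynomialsI) simp
qed

lemma diff_mem_homogeneous_polynomials:
  assumes "f \<in> homogeneous_polynomials m" "g \<in> homogeneous_polynomials m"
  shows "f - g \<in> homogeneous_polynomials m"
proof -
  obtain L where L: "continuous_multilinear_form m L" "\<And>x. f x = L (\<lambda>i\<in>{..<m}. x)"
    using homogeneous_polynomialsE[OF assms(1)] by blast
  obtain M where M: "continuous_multilinear_form m M" "\<And>x. g x = M (\<lambda>i\<in>{..<m}. x)"
    using homogeneous_polynomialsE[OF assms(2)] by blast
  have "continuous_multilinear_form m (\<lambda>x. L x - M x)"
    using L(1) M(1) unfolding continuous_multilinear_form_def clinear_iff
    by (auto simp: scaleC_complex_def algebra_simps intro: continuous_map_diff)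
  then show ?thesis
    by (rule homogeneous_polynomialsI) (simp add: L(2) M(2))
qed

lemma comp_clinear_mem_homogeneous_polynomials:
  fixes \<phi> :: "'a::complex_banach \<Rightarrow> 'a"
  assumes p: "p \<in> homogeneous_polynomials m" and \<phi>: "clinear \<phi>" "continuous_on UNIV \<phi>"
  shows "p \<circ> \<phi> \<in> homogeneous_polynomials m"
proof -
  obtain L where L: "continuous_multilinear_form m L" "\<And>x. p x = L (\<lambda>i\<in>{..<m}. x)"
    using homogeneous_polynomialsE[OF p] by blast
  let ?M = "\<lambda>x. L (\<lambda>i\<in>{..<m}. \<phi> (x i))"
  have "clinear (\<lambda>y. ?M (x(i := y)))" if "i < m" for x i
  proof -
    have "(\<lambda>j\<in>{..<m}. \<phi> ((x(i := y)) j)) = (\<lambda>j\<in>{..<m}. \<phi> (x j))(i := \<phi> y)" for y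
      using that by (auto simp: fun_eq_iff)
    moreover have "clinear (\<lambda>y. L ((\<lambda>j\<in>{..<m}. \<phi> (x j))(i := y)))"
      using that by (intro continuous_multilinear_form_clinear[OF L(1)]) auto
    ultimately show ?thesis
      using \<phi>(1) by (simp add: clinear_iff)
  qed
  moreover have "continuous_map (product_topology (\<lambda>_. euclidean) {..<m}) euclidean ?M"
  proof -
    have "continuous_map (product_topology (\<lambda>_. euclidean) {..<m}) euclidean (\<lambda>x. \<phi> (x i))"
      if "i < m" for i
      using continuous_map_compose[OF continuous_map_product_coordinates[of i "{..<m}" "\<lambda>_. euclidean"],
          of euclidean \<phi>] \<phi>(2) that
      by (simp add: o_def)
    then have "continuous_map (product_topology (\<lambda>_. euclidean) {..<m})
        (product_topology (\<lambda>_. euclidean) {..<m}) (\<lambda>x. \<lambda>i\<in>{..<m}. \<phi> (x i))"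
      by (auto simp: continuous_map_componentwise)
    then show ?thesis
      by (rule continuous_map_compose[OF _ continuous_multilinear_form_continuous[OF L(1)], unfolded o_def])
  qed
  ultimately have "continuous_multilinear_form m ?M"
    by (simp add: continuous_multilinear_form_def)
  then show ?thesis
    by (rule homogeneous_polynomialsI) (simp add: L(2) cong: restrict_cong)
qed

lemma continuous_on_homogeneous_polynomial:
  fixes p :: "'a::complex_banach \<Rightarrow> complex"
  assumes "p \<in> homogeneous_polynomials m"
  shows "continuous_on UNIV p"
proof -
  obtain L where L: "continuous_multilinear_form m L" "\<And>x. p x = L (\<lambda>i\<in>{..<m}. x)"
    using homogeneous_polynomialsE[OF assms] by blast
  have "continuous_map euclidean (product_topology (\<lambda>_. euclidean) {..<m}) (\<lambda>x::'a. \<lambda>i\<in>{..<m}. x)"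
    by (auto simp: continuous_map_componentwise)
  then have "continuous_map euclidean euclidean (\<lambda>x. L (\<lambda>i\<in>{..<m}. x))"
    by (rule continuous_map_compose[OF _ continuous_multilinear_form_continuous[OF L(1)], unfolded o_def])
  then show ?thesis
    by (simp add: L(2)[abs_def])
qed

lemma power_clinear_mem_homogeneous_polynomials:
  fixes F :: "'a::complex_banach \<Rightarrow> complex"
  assumes F: "clinear F" "continuous_on UNIV F"
  shows "(\<lambda>x. F x ^ m) \<in> homogeneous_polynomials m"
proof -
  let ?L = "\<lambda>x. \<Prod>i<m. F (x i)"
  have "clinear (\<lambda>y. ?L (x(i := y)))" if "i < m" for x i
  proof -
    have "?L (x(i := y)) = F y * (\<Prod>j\<in>{..<m} - {i}. F (x j))" for y
      using that by (simp add: prod.remove[of "{..<m}" i])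
    then show ?thesis
      using F(1) by (simp add: clinear_iff scaleC_complex_def algebra_simps)
  qed
  moreover have "continuous_map (product_topology (\<lambda>_. euclidean) {..<m}) euclidean ?L"
  proof -
    have "continuous_map (product_topology (\<lambda>_. euclidean) {..<m}) euclidean (\<lambda>x. F (x i))"
      if "i < m" for i
      using continuous_map_compose[OF continuous_map_product_coordinates[of i "{..<m}" "\<lambda>_. euclidean"],
          of euclidean F] F(2) that
      by (simp add: o_def)
    then show ?thesis
      by (auto simp: continuous_map_atin intro!: tendsto_prod)
  qed
  ultimately have "continuous_multilinear_form m ?L"
    by (simp add: continuous_multilinear_form_def)
  then show ?thesis
    by (rule homogeneous_polynomialsI) simp
qed

section \<open>The compact-open topology\<close>

lemma openin_compact_open_ball:
  assumes "f \<in> F" "compact K" "e > 0"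
  shows "openin (compact_open_topology F) {g \<in> F. \<forall>x\<in>K. norm (g x - f x) < e}"
  unfolding compact_open_topology_def using assms by (intro topology_generated_by_Basis) blast

text \<open>The generating sets centred at other functions cause no trouble: if \<open>\<bar>g - f\<bar> < e\<close> on the
  compact set \<open>K\<close>, then \<open>\<bar>g - f\<bar>\<close> attains a maximum below \<open>e\<close> there, which leaves room for a ball
  centred at \<open>g\<close>.\<close>

lemma compact_open_ball_subset:
  fixes F :: "('a::topological_space \<Rightarrow> 'b::real_normed_vector) set"
  assumes cont: "\<And>f. f \<in> F \<Longrightarrow> continuous_on UNIV f"
    and U: "openin (compact_open_topology F) U" "g \<in> U"
  obtains K e where "compact K" "e > 0" "{h \<in> F. \<forall>x\<in>K. norm (h x - g x) < e} \<subseteq> U"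
proof -
  have generated: "generate_topology_on
      {{g \<in> F. \<forall>x\<in>K. norm (g x - f x) < e} | f K e. f \<in> F \<and> compact K \<and> e > 0} U"
    using U(1) unfolding compact_open_topology_def by (rule openin_topology_generated_by)
  define N where "N = (\<lambda>K e. {h \<in> F. \<forall>x\<in>K. norm (h x - g x) < e})"
  have "\<exists>K e. compact K \<and> e > 0 \<and> N K e \<subseteq> U"
    using generated U(2)
  proof (induction rule: generate_topology_on.induct)
    case Empty
    then show ?case by simp
  next
    case (Int U V)
    have "g \<in> U" "g \<in> V" using Int.prems by simp_all
    obtain K e where K: "compact K" "e > 0" "N K e \<subseteq> U"
      using Int.IH(1)[OF \<open>g \<in> U\<close>] by blast
    obtain K' e' where K': "compact K'" "e' > 0" "N K' e' \<subseteq> V"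
      using Int.IH(2)[OF \<open>g \<in> V\<close>] by blast
    have "N (K \<union> K') (min e e') \<subseteq> N K e \<inter> N K' e'"
      by (auto simp: N_def)
    then have "N (K \<union> K') (min e e') \<subseteq> U \<inter> V"
      using K(3) K'(3) by blast
    moreover have "compact (K \<union> K')" "min e e' > 0"
      using K K' by (simp_all add: compact_Un)
    ultimately show ?case by blast
  next
    case (UN \<U>)
    then obtain V where V: "V \<in> \<U>" "g \<in> V" by blast
    then obtain K e where "compact K" "e > 0" "N K e \<subseteq> V"
      using UN.IH[OF V] by blast
    then show ?case using V(1) by blast
  next
    case (Basis U)
    then obtain f K e where U: "U = {g \<in> F. \<forall>x\<in>K. norm (g x - f x) < e}"
      and f: "f \<in> F" and K: "compact K" and e: "e > 0" by blast
    have g: "g \<in> F" "\<And>x. x \<in> K \<Longrightarrow> norm (g x - f x) < e"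
      using Basis.prems U by auto
    obtain r where r: "r < e" "\<And>x. x \<in> K \<Longrightarrow> norm (g x - f x) \<le> r"
    proof (cases "K = {}")
      case True
      then show thesis using that[of 0] e by simp
    next
      case False
      have "continuous_on K (\<lambda>x. norm (g x - f x))"
        using cont[OF f] cont[OF g(1)]
        by (intro continuous_intros) (auto intro: continuous_on_subset)
      then show thesis
        using continuous_attains_sup[OF K False] g(2) that by blast
    qed
    have "norm (h x - f x) < e" if "x \<in> K" "norm (h x - g x) < e - r" for h x
      using r(2)[OF that(1)] that(2) norm_triangle_ineq[of "h x - g x" "g x - f x"] by simp
    then have "N K (e - r) \<subseteq> U"
      by (auto simp: U N_def)
    moreover have "e - r > 0" using r(1) by simp
    ultimately show ?case using K by blast
  qed
  then show thesis using that unfolding N_def by blast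
qed

lemma continuous_map_composition_operator:
  fixes \<phi> :: "'a::topological_space \<Rightarrow> 'a" and F :: "('a \<Rightarrow> 'b::real_normed_vector) set"
  assumes cont: "\<And>f. f \<in> F \<Longrightarrow> continuous_on UNIV f" and \<phi>: "continuous_on UNIV \<phi>"
    and comp: "\<And>f. f \<in> F \<Longrightarrow> f \<circ> \<phi> \<in> F"
  shows "continuous_map (compact_open_topology F) (compact_open_topology F) (composition_operator \<phi>)"
  unfolding continuous_map_def
proof (intro conjI allI impI)
  show "composition_operator \<phi> \<in> topspace (compact_open_topology F) \<rightarrow> topspace (compact_open_topology F)"
    using comp by (simp add: composition_operator_def)
next
  fix U
  assume U: "openin (compact_open_topology F) U"
  show "openin (compact_open_topology F)
      {f \<in> topspace (compact_open_topology F). composition_operator \<phi> f \<in> U}"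
  proof (subst openin_subopen, clarify)
    fix f
    assume "f \<in> topspace (compact_open_topology F)" "composition_operator \<phi> f \<in> U"
    then have f: "f \<in> F" "f \<circ> \<phi> \<in> U" by (simp_all add: composition_operator_def)
    obtain K e where K: "compact K" "e > 0" "{h \<in> F. \<forall>x\<in>K. norm (h x - (f \<circ> \<phi>) x) < e} \<subseteq> U"
      using compact_open_ball_subset[OF cont U f(2)] .
    let ?V = "{g \<in> F. \<forall>x\<in>\<phi> ` K. norm (g x - f x) < e}"
    have "compact (\<phi> ` K)"
      using K(1) \<phi> by (intro compact_continuous_image) (auto intro: continuous_on_subset)
    then have "openin (compact_open_topology F) ?V"
      using f(1) K(2) by (intro openin_compact_open_ball)
    moreover have "f \<in> ?V" using f(1) K(2) by simp
    moreover have "g \<circ> \<phi> \<in> U" if "g \<in> ?V" for g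
      using K(3) comp that by auto
    ultimately show "\<exists>V. openin (compact_open_topology F) V \<and> f \<in> V \<and>
        V \<subseteq> {f \<in> topspace (compact_open_topology F). composition_operator \<phi> f \<in> U}"
      by (intro exI[of _ ?V]) (auto simp: composition_operator_def)
  qed
qed

section \<open>Power boundedness and stable orbits\<close>

lemma funpow_composition_operator: "(composition_operator \<phi> ^^ n) p = p \<circ> (\<phi> ^^ n)"
proof (induction n)
  case (Suc n)
  have "(composition_operator \<phi> ^^ Suc n) p = p \<circ> ((\<phi> ^^ n) \<circ> \<phi>)"
    unfolding funpow.simps(2) comp_apply[of "composition_operator \<phi>"] Suc.IH
    by (simp add: composition_operator_def fun_eq_iff)
  then show ?case
    by (simp only: funpow_Suc_right)
qed (simp add: fun_eq_iff)

lemma funpow_clinear_continuous: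
  fixes \<phi> :: "'a::complex_banach \<Rightarrow> 'a"
  assumes "clinear \<phi>" "continuous_on UNIV \<phi>"
  shows "clinear (\<phi> ^^ n)" "continuous_on UNIV (\<phi> ^^ n)"
proof -
  show "clinear (\<phi> ^^ n)"
    using assms(1) by (induction n) (auto simp: clinear_iff)
  show "continuous_on UNIV (\<phi> ^^ n)"
    by (induction n)
      (auto simp: id_def o_def intro: continuous_on_compose2[OF assms(2)] continuous_on_id)
qed

lemma stable_orbits_imp_power_bounded:
  fixes \<phi> :: "'a::complex_banach \<Rightarrow> 'a"
  assumes \<phi>: "clinear \<phi>" "continuous_on UNIV \<phi>" and stable: "stable_orbits \<phi>"
  shows "power_bounded (compact_open_topology (homogeneous_polynomials m)) (composition_operator \<phi>)"
proof -
  let ?P = "homogeneous_polynomials m :: ('a \<Rightarrow> complex) set"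
  note cont = continuous_on_homogeneous_polynomial[where m = m]
  have comp: "f \<circ> (\<phi> ^^ n) \<in> ?P" if "f \<in> ?P" for f n
    using comp_clinear_mem_homogeneous_polynomials[OF that funpow_clinear_continuous[OF \<phi>]] .
  have "continuous_map (compact_open_topology ?P) (compact_open_topology ?P) (composition_operator \<phi>)"
    using comp[where n = 1] by (intro continuous_map_composition_operator[OF cont \<phi>(2)]) simp_all
  moreover have "equicontinuous_family (compact_open_topology ?P) (\<lambda>n. composition_operator \<phi> ^^ n)"
    unfolding equicontinuous_family_def
  proof (intro ballI allI impI, elim conjE)
    fix f V
    assume "f \<in> topspace (compact_open_topology ?P)"
      and V: "openin (compact_open_topology ?P) V" "0 \<in> V"
    then have f: "f \<in> ?P" by simp
    obtain K e where K: "compact K" "e > 0" "{h \<in> ?P. \<forall>x\<in>K. cmod (h x - 0 x) < e} \<subseteq> V"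
      using compact_open_ball_subset[OF cont V] .
    obtain L where L: "compact L" "\<And>n. (\<phi> ^^ n) ` K \<subseteq> L"
      using stable K(1) unfolding stable_orbits_def by blast
    let ?U = "{g \<in> ?P. \<forall>x\<in>L. cmod (g x - f x) < e}"
    have "openin (compact_open_topology ?P) ?U"
      using f L(1) K(2) by (rule openin_compact_open_ball)
    moreover have "f \<in> ?U" using f K(2) by simp
    moreover have "(composition_operator \<phi> ^^ n) g - (composition_operator \<phi> ^^ n) f \<in> V"
      if "g \<in> ?U" for n g
    proof -
      have "(g \<circ> (\<phi> ^^ n)) - (f \<circ> (\<phi> ^^ n)) \<in> ?P"
        using that f by (intro diff_mem_homogeneous_polynomials comp) auto
      moreover have "cmod (g ((\<phi> ^^ n) x) - f ((\<phi> ^^ n) x)) < e" if "x \<in> K" for x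
        using L(2)[of n] \<open>g \<in> ?U\<close> that by blast
      ultimately show ?thesis
        using K(3) by (auto simp: funpow_composition_operator)
    qed
    ultimately show "\<exists>U. openin (compact_open_topology ?P) U \<and> f \<in> U \<and>
        (\<forall>n. \<forall>g\<in>U. (composition_operator \<phi> ^^ n) g - (composition_operator \<phi> ^^ n) f \<in> V)"
      by (intro exI[of _ ?U]) blast
  qed
  ultimately show ?thesis
    unfolding power_bounded_def
    by (simp add: composition_operator_def fun_eq_iff scaleC_fun_def)
qed

lemma power_bounded_imp_stable_orbits:
  fixes \<phi> :: "'a::complex_banach \<Rightarrow> 'a"
  assumes "m \<ge> 1"
    and pb: "power_bounded (compact_open_topology (homogeneous_polynomials m :: ('a \<Rightarrow> complex) set))
      (composition_operator \<phi>)"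
  shows "stable_orbits \<phi>"
  unfolding stable_orbits_def
proof (intro allI impI)
  fix K :: "'a set"
  assume "compact K"
  let ?P = "homogeneous_polynomials m :: ('a \<Rightarrow> complex) set"
  let ?V = "{g \<in> ?P. \<forall>x\<in>K. cmod (g x - 0 x) < 1}"
  have 0: "0 \<in> ?P" by (rule zero_mem_homogeneous_polynomials)
  have "openin (compact_open_topology ?P) ?V"
    using 0 \<open>compact K\<close> zero_less_one by (rule openin_compact_open_ball)
  moreover have "0 \<in> ?V" using 0 by simp
  ultimately obtain U where U: "openin (compact_open_topology ?P) U" "0 \<in> U"
    "\<And>n g. g \<in> U \<Longrightarrow> (composition_operator \<phi> ^^ n) g - (composition_operator \<phi> ^^ n) 0 \<in> ?V"
    using pb 0 unfolding power_bounded_def equicontinuous_family_def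
    by (metis (no_types, lifting) topspace_compact_open_topology)
  obtain L e where L: "compact L" "e > 0" "{h \<in> ?P. \<forall>x\<in>L. cmod (h x - 0 x) < e} \<subseteq> U"
    using compact_open_ball_subset[OF continuous_on_homogeneous_polynomial[where m = m] U(1,2)] .
  \<comment> \<open>With this \<open>R\<close>, a linear form bounded by \<open>1\<close> on \<open>R \<cdot> L\<close> has \<open>m\<close>-th power at most
    \<open>1 / R ^ m \<le> 1 / R < e\<close> on \<open>L\<close>. Inserting \<open>0\<close> keeps the hull nonempty.\<close>
  define R where "R = 1 + 1 / e"
  have R: "R \<ge> 1" "1 / R < e" using L(2) by (simp_all add: R_def field_simps)
  obtain B where B: "compact B" "convex B" "B \<noteq> {}"
    "\<And>c x. cmod c \<le> 1 \<Longrightarrow> x \<in> B \<Longrightarrow> c *\<^sub>C x \<in> B" "\<And>x. x \<in> insert 0 L \<Longrightarrow> R *\<^sub>R x \<in> B"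
    using compact_absolutely_convex_superset[of "insert 0 L" R] L(1) R(1) by auto
  have "(\<phi> ^^ n) x \<in> B" if "x \<in> K" for n x
  proof (rule ccontr)
    assume "(\<phi> ^^ n) x \<notin> B"
    then obtain F where F: "clinear F" "continuous_on UNIV F" "\<And>y. y \<in> B \<Longrightarrow> cmod (F y) \<le> 1"
      "1 \<le> cmod (F ((\<phi> ^^ n) x))"
      using absolutely_convex_separation[OF compact_imp_closed[OF B(1)] B(2-4)] by metis
    let ?p = "\<lambda>y. F y ^ m"
    have p: "?p \<in> ?P"
      using F(1,2) by (rule power_clinear_mem_homogeneous_polynomials)
    have "cmod (?p y) < e" if "y \<in> L" for y
    proof -
      have "R * cmod (F y) = cmod (F (R *\<^sub>R y))"
        using R(1) linear_scale[OF clinear_imp_linear[OF F(1)], of R y] by simp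
      also have "\<dots> \<le> 1" using F(3) B(5) that by blast
      finally have "cmod (F y) \<le> 1 / R" using R(1) by (simp add: field_simps)
      moreover have "cmod (F y) \<le> 1"
        using order_trans[OF \<open>cmod (F y) \<le> 1 / R\<close>, of 1] R(1) by simp
      then have "cmod (?p y) \<le> cmod (F y)"
        using power_decreasing[of 1 m "cmod (F y)"] \<open>m \<ge> 1\<close> by (simp add: norm_power)
      ultimately show ?thesis using R(2) by simp
    qed
    then have "?p \<in> U" using L(3) p by auto
    from U(3)[OF this, of n] have "cmod (?p ((\<phi> ^^ n) x)) < 1"
      using that by (simp add: funpow_composition_operator)
    then show False
      using one_le_power[OF F(4), of m] by (simp add: norm_power)
  qed
  then show "\<exists>L. compact L \<and> (\<forall>n. (\<phi> ^^ n) ` K \<subseteq> L)"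
    using B(1) by blast
qed

theorem proposition3p4:
  fixes \<phi> :: "'a::complex_banach \<Rightarrow> 'a" and m :: nat
  assumes "m \<ge> 1"
    and "clinear \<phi>"
    and "continuous_on UNIV \<phi>"
  shows "power_bounded
      (compact_open_topology (homogeneous_polynomials m :: ('a \<Rightarrow> complex) set))
      (composition_operator \<phi>)
    \<longleftrightarrow> stable_orbits \<phi>"
  using power_bounded_imp_stable_orbits[OF assms(1)] stable_orbits_imp_power_bounded[OF assms(2,3)]
  by blast

end
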